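(* Let $\mathbb{K}$ be an algebraically closed field of characteristic zero, let $a_1,\dots,a_t$ be positive integers, and let $A=\langle x^{a_1},x^{a_2},\ldots,x^{a_t}\rangle$ be the subalgebra of $\mathbb{K}[x]$ generated by these monomials. There exist $\alpha\neq\beta$ in $\mathbb{K}$ such that $f(\alpha)=f(\beta)$ for all $f\in A$ if and only if $\gcd(a_1,a_2,\ldots,a_t)>1$.
   Context: Subalgebras of $\mathbb{K}[x]$ are unital: $\langle x^{a_1},\dots,x^{a_t}\rangle$ contains all constants. *)

theory Defs
  imports Complex_Main "HOL.Hull" "HOL-Computational_Algebra.Polynomial"
begin

(* Unital: 1 \<in> V together with closure under smult puts all constants into V. *)
definition poly_subalgebra :: "'a::field poly set \<Rightarrow> bool" where
  "poly_subalgebra V \<longleftrightarrow>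
     1 \<in> V \<and>
     (\<forall>p\<in>V. \<forall>q\<in>V. p + q \<in> V) \<and>
     (\<forall>p\<in>V. \<forall>q\<in>V. p * q \<in> V) \<and>
     (\<forall>c. \<forall>p\<in>V. smult c p \<in> V)"

definition generated_subalgebra :: "'a::field poly set \<Rightarrow> 'a poly set" where
  "generated_subalgebra S = poly_subalgebra hull S"

lemma poly_subalgebra_generated: "poly_subalgebra (generated_subalgebra S)"
  unfolding generated_subalgebra_def by (rule hull_in) (auto simp: poly_subalgebra_def)

end

theory Submission
  imports Defs
begin

text \<open>
  Evaluation at a point respects sums, products and scalars, so two points have equal values
  on a whole generated subalgebra as soon as they have equal values on the generators. The
  question is therefore when distinct \<open>\<alpha>, \<beta>\<close> can satisfy \<open>\<alpha> ^ a i = \<beta> ^ a i\<close> for all \<open>i\<close>.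
  As the exponents are positive, such points are both nonzero, and the condition says that the
  quotient \<open>u = \<alpha> / \<beta>\<close> is a common root of unity for all these exponents, which amounts to
  \<open>u ^ d = 1\<close> for their gcd \<open>d\<close>. For \<open>d = 1\<close> this forces \<open>\<alpha> = \<beta>\<close>; for \<open>d > 1\<close> an
  algebraically closed field of characteristic zero has such a \<open>u \<noteq> 1\<close>, and the points \<open>u\<close> and
  \<open>1\<close> are not separated.
\<close>

text \<open>
  The polynomials taking equal values at \<open>\<alpha>\<close> and \<open>\<beta>\<close> themselves form a subalgebra, which
  contains the hull of any of its subsets.
\<close>
lemma generated_subalgebra_poly_eq_iff:
  "(\<forall>f\<in>generated_subalgebra S. poly f \<alpha> = poly f \<beta>) \<longleftrightarrow> (\<forall>s\<in>S. poly s \<alpha> = poly s \<beta>)"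
proof
  assume "\<forall>f\<in>generated_subalgebra S. poly f \<alpha> = poly f \<beta>"
  then show "\<forall>s\<in>S. poly s \<alpha> = poly s \<beta>"
    unfolding generated_subalgebra_def by (blast intro: hull_inc)
next
  assume "\<forall>s\<in>S. poly s \<alpha> = poly s \<beta>"
  moreover have "poly_subalgebra {f. poly f \<alpha> = poly f \<beta>}"
    by (simp add: poly_subalgebra_def)
  ultimately have "generated_subalgebra S \<subseteq> {f. poly f \<alpha> = poly f \<beta>}"
    unfolding generated_subalgebra_def by (intro hull_minimal) auto
  then show "\<forall>f\<in>generated_subalgebra S. poly f \<alpha> = poly f \<beta>"
    by blast
qed

text \<open>
  The least positive exponent \<open>m\<close> with \<open>u ^ m = 1\<close> (the multiplicative order of \<open>u\<close>) divides
  every \<open>n\<close> with \<open>u ^ n = 1\<close>, because \<open>n mod m\<close> is a smaller exponent of the same kind; hence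
  it divides the gcd.
\<close>
lemma power_Gcd_eq_1:
  fixes u :: "'a::monoid_mult"
  assumes "\<And>n. n \<in> N \<Longrightarrow> u ^ n = 1"
  shows "u ^ Gcd N = 1"
proof (cases "N \<subseteq> {0}")
  case True
  then have "Gcd N = 0" by (simp add: Gcd_0_iff)
  then show ?thesis by (simp only: power_0)
next
  case False
  then have ex: "\<exists>m. m > 0 \<and> u ^ m = 1"
    using assms by auto
  define m where "m = (LEAST m. m > 0 \<and> u ^ m = 1)"
  have m: "m > 0" "u ^ m = 1"
    using LeastI_ex [OF ex] unfolding m_def by blast+
  have m_le: "m \<le> k" if "k > 0" "u ^ k = 1" for k
    unfolding m_def by (rule Least_le) (use that in simp)
  have "m dvd n" if "n \<in> N" for n
  proof -
    have "u ^ n = u ^ (m * (n div m) + n mod m)" by simp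
    also have "\<dots> = u ^ (n mod m)"
      unfolding power_add power_mult m(2) by simp
    finally have "u ^ (n mod m) = 1" using assms [OF that] by simp
    moreover have "n mod m < m" using m(1) by simp
    ultimately have "n mod m = 0"
      using m_le [of "n mod m"] by linarith
    then show ?thesis by auto
  qed
  then have "m dvd Gcd N" by (rule Gcd_greatest)
  then obtain k where "Gcd N = m * k" ..
  then show ?thesis
    by (simp add: power_mult m(2))
qed

text \<open>
  A root of \<open>1 + x + \<dots> + x ^ (d - 1)\<close>, a factor of \<open>x ^ d - 1\<close>, serves as witness: at \<open>x = 1\<close>
  this polynomial has the value \<open>d\<close>, which is nonzero in characteristic zero.
\<close>
lemma nontrivial_root_of_unity_exists:
  assumes "d > 1"
  shows "\<exists>u :: 'a :: {alg_closed_field, field_char_0}. u \<noteq> 1 \<and> u ^ d = 1"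
proof -
  have "\<exists>u :: 'a. (\<Sum>k\<le>d - 1. 1 * u ^ k) = 0"
    using assms by (intro alg_closed) auto
  then obtain u :: 'a where "(\<Sum>k\<le>d - 1. u ^ k) = 0"
    by auto
  moreover have "{..d - 1} = {..<d}"
    using assms by auto
  ultimately have u: "(\<Sum>k<d. u ^ k) = 0"
    by simp
  have "u \<noteq> 1"
    using u assms by auto
  moreover have "u ^ d = 1"
    using power_diff_1_eq [of u d] u by simp
  ultimately show ?thesis by blast
qed

theorem theorem2:
  fixes a :: "nat \<Rightarrow> nat" and t :: nat
    and A :: "'a :: {alg_closed_field, field_char_0} poly set"
  assumes "t \<ge> 1"
    and "\<And>i. i \<in> {1..t} \<Longrightarrow> a i > 0"
    and "A = generated_subalgebra ((\<lambda>i. monom 1 (a i)) ` {1..t})"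
  shows "(\<exists>\<alpha> \<beta> :: 'a. \<alpha> \<noteq> \<beta> \<and> (\<forall>f\<in>A. poly f \<alpha> = poly f \<beta>))
           \<longleftrightarrow> Gcd (a ` {1..t}) > 1"
proof -
  define d where "d = Gcd (a ` {1..t})"
  have one: "1 \<in> {1..t}" using assms(1) by simp
  have A_iff: "(\<forall>f\<in>A. poly f \<alpha> = poly f \<beta>) \<longleftrightarrow> (\<forall>i\<in>{1..t}. \<alpha> ^ a i = \<beta> ^ a i)" for \<alpha> \<beta>
    by (simp add: assms(3) generated_subalgebra_poly_eq_iff poly_monom)
  have "d > 1" if "\<alpha> \<noteq> \<beta>" and eq: "\<forall>i\<in>{1..t}. \<alpha> ^ a i = \<beta> ^ a i" for \<alpha> \<beta> :: 'a
  proof -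
    have "\<alpha> ^ a 1 = \<beta> ^ a 1" "a 1 > 0"
      using eq one assms(2) by blast+
    then have "\<beta> \<noteq> 0" using \<open>\<alpha> \<noteq> \<beta>\<close> by (auto simp: zero_power)
    then have "(\<alpha> / \<beta>) ^ d = 1"
      unfolding d_def using eq by (intro power_Gcd_eq_1) (auto simp: power_divide)
    moreover have "\<alpha> / \<beta> \<noteq> 1" using \<open>\<alpha> \<noteq> \<beta>\<close> \<open>\<beta> \<noteq> 0\<close> by simp
    ultimately have "d \<noteq> 1" by auto
    moreover have "d dvd a 1"
      unfolding d_def by (rule Gcd_dvd [OF imageI [OF one]])
    then have "d \<noteq> 0" using \<open>a 1 > 0\<close> by (intro notI) simp
    ultimately show ?thesis by simp
  qed
  moreover have "\<exists>\<alpha> \<beta> :: 'a. \<alpha> \<noteq> \<beta> \<and> (\<forall>i\<in>{1..t}. \<alpha> ^ a i = \<beta> ^ a i)"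
    if d_gt_1: "d > 1"
  proof -
    obtain u :: 'a where u: "u \<noteq> 1" "u ^ d = 1"
      using nontrivial_root_of_unity_exists [OF d_gt_1] by blast
    have "u ^ a i = 1 ^ a i" if "i \<in> {1..t}" for i
    proof -
      have "d dvd a i" using that unfolding d_def by (intro Gcd_dvd) simp
      then obtain k where "a i = d * k" ..
      then show ?thesis by (simp add: power_mult u(2))
    qed
    with u(1) show ?thesis by blast
  qed
  ultimately show ?thesis unfolding A_iff d_def [symmetric] by blast
qed

end
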